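(* Let $X$ be a median algebra of subinfinite rank (in particular, of finite rank). Let $(f_n)_{n\in\mathbb N}$ be a uniformly bounded sequence of median-preserving maps $f_n:X\to\mathbb R$. Then $(f_n)$ admits a pointwise convergent subsequence, and its pointwise limit $f:X\to\mathbb R$ is again median-preserving. Equivalently, for every compact interval $I\subset\mathbb R$, the family $\mathcal M(X,I)$ of all median-preserving maps $X\to I$ is sequentially compact in the pointwise topology of $I^X$. In particular, $\mathcal M(X,[0,1])$ is sequentially compact.
   Context: A median algebra is a set $X$ with a ternary operation $m:X^3\to X$ such that $m$ is invariant under permutations of its arguments, $m(a,b,b)=b$, and $m(m(a,x,b),x,c)=m(a,x,m(b,x,c))$ for all $a,b,c,x\in X$. A map $f:X_1\to X_2$ between median algebras is median-preserving if $f(m(x,y,z))=m(f(x),f(y),f(z))$ for all $x,y,z$. The line $\mathbb R$ and its intervals are median algebras with $m(a,b,c)$ the middle value of $a,b,c$; $\{0,1\}^n$ carries the coordinatewise median. For $x,y\in X$ put $[x,y]=\{z\in X: m(x,y,z)=z\}$; a subset $C\subseteq X$ is convex if $[x,y]\subseteq C$ for all $x,y\in C$. A halfspace is a nonempty convex subset of $X$ whose complement is nonempty and convex. Two halfspaces $A_1,A_2$ are crossing if all four sets $A_1\cap A_2$, $A_1\cap A_2^c$, $A_1^c\cap A_2$, $A_1^c\cap A_2^c$ are nonempty. $X$ has subinfinite rank if every set of pairwise crossing halfspaces of $X$ is finite. $X$ has finite rank if the supremum of the $n\in\mathbb N$ such that $\{0,1\}^n$ embeds in $X$ as a median subalgebra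 is finite. *)

theory Defs
  imports "HOL-Analysis.Analysis" "HOL-Library.Extended_Nat"
begin

section \<open>Median algebras\<close>

text \<open>The two transpositions in \<open>swap12\<close> and \<open>swap23\<close> generate all permutations of the
  arguments. The carrier may be empty.\<close>

locale median_algebra =
  fixes X :: "'a set" and m :: "'a \<Rightarrow> 'a \<Rightarrow> 'a \<Rightarrow> 'a"
  assumes closed: "\<lbrakk>a \<in> X; b \<in> X; c \<in> X\<rbrakk> \<Longrightarrow> m a b c \<in> X"
    and swap12: "\<lbrakk>a \<in> X; b \<in> X; c \<in> X\<rbrakk> \<Longrightarrow> m a b c = m b a c"
    and swap23: "\<lbrakk>a \<in> X; b \<in> X; c \<in> X\<rbrakk> \<Longrightarrow> m a b c = m a c b"
    and majority: "\<lbrakk>a \<in> X; b \<in> X\<rbrakk> \<Longrightarrow> m a b b = b"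
    and assoc: "\<lbrakk>a \<in> X; b \<in> X; c \<in> X; x \<in> X\<rbrakk> \<Longrightarrow> m (m a x b) x c = m a x (m b x c)"

definition median_preserving ::
    "'a set \<Rightarrow> ('a \<Rightarrow> 'a \<Rightarrow> 'a \<Rightarrow> 'a) \<Rightarrow> 'b set \<Rightarrow> ('b \<Rightarrow> 'b \<Rightarrow> 'b \<Rightarrow> 'b) \<Rightarrow> ('a \<Rightarrow> 'b) \<Rightarrow> bool" where
  "median_preserving X m Y m' f \<longleftrightarrow>
     f \<in> X \<rightarrow> Y \<and> (\<forall>x\<in>X. \<forall>y\<in>X. \<forall>z\<in>X. f (m x y z) = m' (f x) (f y) (f z))"

definition real_median :: "real \<Rightarrow> real \<Rightarrow> real \<Rightarrow> real" where
  "real_median a b c = max (min a b) (min (max a b) c)"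

lemma real_median_eq_middle: "real_median a b c = sort [a, b, c] ! 1"
  by (auto simp: real_median_def max_def min_def)

lemma median_algebra_real: "median_algebra I real_median"
  by unfold_locales (auto simp: real_median_def max_def min_def)

section \<open>Halfspaces and subinfinite rank\<close>

definition median_interval :: "'a set \<Rightarrow> ('a \<Rightarrow> 'a \<Rightarrow> 'a \<Rightarrow> 'a) \<Rightarrow> 'a \<Rightarrow> 'a \<Rightarrow> 'a set" where
  "median_interval X m x y = {z \<in> X. m x y z = z}"

definition median_convex :: "'a set \<Rightarrow> ('a \<Rightarrow> 'a \<Rightarrow> 'a \<Rightarrow> 'a) \<Rightarrow> 'a set \<Rightarrow> bool" where
  "median_convex X m C \<longleftrightarrow> C \<subseteq> X \<and> (\<forall>x\<in>C. \<forall>y\<in>C. median_interval X m x y \<subseteq> C)"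

definition median_halfspace :: "'a set \<Rightarrow> ('a \<Rightarrow> 'a \<Rightarrow> 'a \<Rightarrow> 'a) \<Rightarrow> 'a set \<Rightarrow> bool" where
  "median_halfspace X m A \<longleftrightarrow>
     A \<noteq> {} \<and> median_convex X m A \<and> X - A \<noteq> {} \<and> median_convex X m (X - A)"

definition crossing :: "'a set \<Rightarrow> 'a set \<Rightarrow> 'a set \<Rightarrow> bool" where
  "crossing X A B \<longleftrightarrow>
     A \<inter> B \<noteq> {} \<and> A \<inter> (X - B) \<noteq> {} \<and> (X - A) \<inter> B \<noteq> {} \<and> (X - A) \<inter> (X - B) \<noteq> {}"

text \<open>The library constant \<^const>\<open>pairwise\<close> only compares distinct members;
  no halfspace crosses itself.\<close>

definition subinfinite_rank :: "'a set \<Rightarrow> ('a \<Rightarrow> 'a \<Rightarrow> 'a \<Rightarrow> 'a) \<Rightarrow> bool" where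
  "subinfinite_rank X m \<longleftrightarrow>
     (\<forall>\<H>. (\<forall>A\<in>\<H>. median_halfspace X m A) \<and> pairwise (crossing X) \<H> \<longrightarrow> finite \<H>)"

section \<open>Rank\<close>

definition cube :: "nat \<Rightarrow> (nat \<Rightarrow> real) set" where
  "cube n = {..<n} \<rightarrow>\<^sub>E {0, 1}"

definition cube_median ::
    "nat \<Rightarrow> (nat \<Rightarrow> real) \<Rightarrow> (nat \<Rightarrow> real) \<Rightarrow> (nat \<Rightarrow> real) \<Rightarrow> nat \<Rightarrow> real" where
  "cube_median n u v w = (\<lambda>i\<in>{..<n}. real_median (u i) (v i) (w i))"

definition cube_embeds :: "'a set \<Rightarrow> ('a \<Rightarrow> 'a \<Rightarrow> 'a \<Rightarrow> 'a) \<Rightarrow> nat \<Rightarrow> bool" where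
  "cube_embeds X m n \<longleftrightarrow>
     (\<exists>\<phi>. median_preserving (cube n) (cube_median n) X m \<phi> \<and> inj_on \<phi> (cube n))"

definition median_rank :: "'a set \<Rightarrow> ('a \<Rightarrow> 'a \<Rightarrow> 'a \<Rightarrow> 'a) \<Rightarrow> enat" where
  "median_rank X m = (SUP n\<in>{n. cube_embeds X m n}. enat n)"

definition finite_rank :: "'a set \<Rightarrow> ('a \<Rightarrow> 'a \<Rightarrow> 'a \<Rightarrow> 'a) \<Rightarrow> bool" where
  "finite_rank X m \<longleftrightarrow> median_rank X m < \<infinity>"

section \<open>Sequential compactness and spaces of median-preserving maps\<close>

text \<open>The counterpart of \<^const>\<open>seq_compact\<close> for abstract topologies.\<close>

definition seq_compactin :: "'a topology \<Rightarrow> 'a set \<Rightarrow> bool" where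
  "seq_compactin T S \<longleftrightarrow> S \<subseteq> topspace T \<and>
     (\<forall>\<sigma> :: nat \<Rightarrow> 'a. (\<forall>n. \<sigma> n \<in> S) \<longrightarrow>
        (\<exists>l\<in>S. \<exists>r :: nat \<Rightarrow> nat. strict_mono r \<and> limitin T (\<sigma> \<circ> r) l sequentially))"

lemma seq_compactin_euclidean: "seq_compactin euclidean S \<longleftrightarrow> seq_compact S"
  by (simp add: seq_compactin_def seq_compact_def)

text \<open>The pointwise topology of \<open>I\<^sup>X\<close>. Its points, the maps \<open>X \<rightarrow> I\<close>, are represented by
  functions that are \<^const>\<open>undefined\<close> outside \<open>X\<close>.\<close>

definition pointwise_topology :: "'a set \<Rightarrow> real set \<Rightarrow> ('a \<Rightarrow> real) topology" where
  "pointwise_topology X I = product_topology (\<lambda>_. top_of_set I) X"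

definition median_maps :: "'a set \<Rightarrow> ('a \<Rightarrow> 'a \<Rightarrow> 'a \<Rightarrow> 'a) \<Rightarrow> real set \<Rightarrow> ('a \<Rightarrow> real) set" where
  "median_maps X m I = {f \<in> X \<rightarrow>\<^sub>E I. median_preserving X m I real_median f}"

end

(* Rank: if H_0, ..., H_n are pairwise crossing halfspaces, Helly's theorem gives points a outside
   all of them, b inside all of them, and y_i inside H_i only. The interval [a,b] is a distributive
   lattice with meet m(a,.,.) and join m(b,.,.). With c the join of all meets of y_i and y_j (i <> j),
   the elements y_i v c are pairwise disjoint over c, so their joins form a cube, and the H_i
   separate its vertices.

   Compactness: for median-preserving f_n and a real q, the sets {f_n < q} are halfspaces (or trivial).
   By Ramsey's theorem some subsequence of them is pairwise crossing, which subinfinite rank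
   excludes, or increasing, decreasing, pairwise disjoint or pairwise co-disjoint. In the latter cases
   the indicator functions converge pointwise. A diagonal argument over rational q makes f_n converge. *)

theory Submission
  imports Defs "HOL-Library.Ramsey" "HOL-Library.Diagonal_Subsequence"
begin

section \<open>Intervals and gates in median algebras\<close>

context median_algebra
begin

abbreviation I :: "'a \<Rightarrow> 'a \<Rightarrow> 'a set" where
  "I \<equiv> median_interval X m"

lemma in_carrier: "z \<in> I x y \<Longrightarrow> z \<in> X"
  by (simp add: median_interval_def)

lemma interval_eq: "z \<in> I x y \<Longrightarrow> m x y z = z"
  by (simp add: median_interval_def)

lemma interval_iff: "z \<in> X \<Longrightarrow> z \<in> I x y \<longleftrightarrow> m x y z = z"
  by (simp add: median_interval_def)

lemma median_permute:
  assumes "x \<in> X" "y \<in> X" "z \<in> X"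
  shows "m x z y = m x y z" "m y x z = m x y z" "m y z x = m x y z" "m z x y = m x y z" "m z y x = m x y z"
proof -
  show 1: "m x z y = m x y z" using swap23[OF assms(1,3,2)] .
  show 2: "m y x z = m x y z" using swap12[OF assms(2,1,3)] .
  show 3: "m y z x = m x y z" using swap23[OF assms(2,3,1)] 2 by (rule trans)
  show 4: "m z x y = m x y z" using swap12[OF assms(3,1,2)] 1 by (rule trans)
  show "m z y x = m x y z" using swap23[OF assms(3,2,1)] 4 by (rule trans)
qed

lemma interval_commute: "\<lbrakk>x \<in> X; y \<in> X; z \<in> I x y\<rbrakk> \<Longrightarrow> z \<in> I y x"
  using swap12[of y x z] by (simp add: median_interval_def)

lemma interval_endpoints:
  assumes "x \<in> X" "y \<in> X" shows "x \<in> I x y" "y \<in> I x y"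
  using assms majority[of y x] majority[of x y] median_permute[of y x x]
  by (simp_all add: median_interval_def)

lemma interval_singleton: "\<lbrakk>x \<in> X; z \<in> I x x\<rbrakk> \<Longrightarrow> z = x"
  using median_permute[of z x x] majority[of z x] by (simp add: median_interval_def)

lemma median_in_interval1:
  assumes "x \<in> X" "y \<in> X" "z \<in> X" shows "m x y z \<in> I x y"
proof -
  have "m (m x y x) y z = m x y (m x y z)" using assoc[of x x z y] assms by simp
  moreover have "m x y x = x" using median_permute[of y x x] majority[of y x] assms by simp
  ultimately show ?thesis using assms closed by (simp add: interval_iff)
qed

lemma median_in_interval:
  assumes "x \<in> X" "y \<in> X" "z \<in> X"
  shows "m x y z \<in> I x y" "m x y z \<in> I y z" "m x y z \<in> I x z"
    and "m x y z \<in> I y x" "m x y z \<in> I z y" "m x y z \<in> I z x"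
proof -
  show xy: "m x y z \<in> I x y" and yz: "m x y z \<in> I y z" and xz: "m x y z \<in> I x z"
    using assms median_in_interval1[of x y z] median_in_interval1[of y z x]
      median_in_interval1[of x z y] median_permute[of x y z] by simp_all
  show "m x y z \<in> I y x" "m x y z \<in> I z y" "m x y z \<in> I z x"
    using interval_commute assms xy yz xz by simp_all
qed

text \<open>The points \<open>a\<close>, \<open>x\<close>, \<open>y\<close>, \<open>b\<close> occur
  in this order. Writing \<open>x\<close> as a median of \<open>x\<close>, \<open>y\<close> and
  \<open>a\<close>, \<open>assoc\<close> brings \<open>b\<close> next to \<open>y\<close>, where
  \<open>m a y b\<close> collapses to \<open>y\<close>.\<close>

lemma interval_chain:
  assumes "a \<in> X" "b \<in> X" "y \<in> I a b" "x \<in> I a y"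
  shows "y \<in> I x b" "x \<in> I a b"
proof -
  have X: "x \<in> X" "y \<in> X" using assms in_carrier by auto
  have x: "m x y a = x" "m x a y = x"
    using interval_eq[OF assms(4)] median_permute[of a y x] assms X by simp_all
  have y: "m a y b = y" "m y a b = y"
    using interval_eq[OF assms(3)] median_permute[of a b y] assms X by simp_all
  have "m x y b = m x y (m a y b)" using assoc[of x a b y] x assms X by simp
  then have "m x y b = y" using y majority X by simp
  then show "y \<in> I x b" using X assms median_permute[of x y b] by (simp add: interval_iff)
  have "m x a b = m x a (m y a b)" using assoc[of x y b a] x assms X by simp
  then have "m x a b = x" using y x by simp
  then show "x \<in> I a b" using X assms median_permute[of x a b] by (simp add: interval_iff)
qed

text \<open>Antisymmetry of the order with least element \<open>x\<close> in which \<open>k\<close>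
  is below \<open>g\<close> when \<open>k\<close> lies in \<open>I x g\<close>.\<close>

lemma interval_antisym:
  assumes "x \<in> X" "k \<in> I x g" "g \<in> I x k" shows "g = k"
  using interval_eq[OF assms(2)] interval_eq[OF assms(3)]
    swap23[OF assms(1) in_carrier[OF assms(2)] in_carrier[OF assms(3)]] by argo

text \<open>In the order based at \<open>h\<close>, the operation \<open>m h\<close> is the meet;
  this is its greatest-lower-bound property.\<close>

lemma interval_meet:
  assumes "h \<in> X" "x \<in> X" "y \<in> X" "g \<in> I h x" "g \<in> I h y"
  shows "g \<in> I h (m h x y)"
proof -
  have g: "g \<in> X" using assms in_carrier by auto
  have e: "m g h x = g" "m g h y = g"
    using assms g interval_eq[OF assms(4)] interval_eq[OF assms(5)]
      median_permute[of h x g] median_permute[of h y g]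
    by simp_all
  have "m g h (m x h y) = g" using assoc[of g x y h] e assms g by simp
  then show ?thesis using assms g closed median_permute(2)[of h x y] median_permute(3)[of g h "m h x y"]
    by (simp add: interval_iff)
qed

text \<open>By \<open>interval_meet\<close>, \<open>g\<close> is below the median in the orders
  based at \<open>x\<close> and at \<open>y\<close>. The first fact puts the median between
  \<open>g\<close> and \<open>y\<close>, so antisymmetry at \<open>y\<close> applies.\<close>

lemma median_unique:
  assumes "x \<in> X" "y \<in> X" "z \<in> X" "g \<in> I x y" "g \<in> I y z" "g \<in> I x z"
  shows "g = m x y z"
proof -
  let ?k = "m x y z"
  have X: "g \<in> X" "?k \<in> X" using assms in_carrier closed by auto
  have gx: "g \<in> I x ?k" using interval_meet assms by blast
  have "g \<in> I y x" using interval_commute assms by simp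
  then have "g \<in> I y (m y x z)" using interval_meet assms by simp
  then have gy: "g \<in> I y ?k" using median_permute(2)[of x y z] assms by simp
  have "?k \<in> I g y"
    using interval_chain(1)[OF assms(1,2) median_in_interval(1)[OF assms(1-3)] gx] .
  then have "?k \<in> I y g" by (rule interval_commute[OF X(1) assms(2)])
  then show ?thesis by (rule interval_antisym[OF assms(2) _ gy])
qed

text \<open>\<open>m x y z\<close> is the gate of \<open>x\<close> in \<open>I y z\<close>. Seen
  from \<open>z\<close>, the point \<open>t = m z x w\<close> is below both \<open>x\<close> and
  \<open>y\<close>, hence below the gate; so the gate lies between \<open>x\<close> and
  \<open>t\<close>, and \<open>t\<close> lies between \<open>x\<close> and \<open>w\<close>.\<close>

lemma gate:
  assumes "x \<in> X" "y \<in> X" "z \<in> X" "w \<in> I y z"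
  shows "m x y z \<in> I x w"
proof -
  define t where "t = m z x w"
  define g where "g = m x y z"
  have X: "w \<in> X" "t \<in> X" "g \<in> X" using assms in_carrier closed t_def g_def by auto
  have w: "w \<in> I z y" using assms interval_commute by blast
  have t1: "t \<in> I z x" and t2: "t \<in> I z w" and t3: "t \<in> I x w"
    using median_in_interval[of z x w] X assms t_def by auto
  have t4: "t \<in> I z y" using interval_chain(2)[OF _ _ w t2] assms by blast
  have "g = m z x y" using median_permute(4)[of x y z] assms g_def by simp
  then have tg: "t \<in> I z g" using interval_meet[OF _ _ _ t1 t4] assms by simp
  have g: "g \<in> I z x" "g \<in> I z y" "g \<in> I x y"
    using median_in_interval[of x y z] assms g_def by auto
  have "g \<in> I t x" "g \<in> I t y"
    using interval_chain(1)[OF _ _ g(1) tg] interval_chain(1)[OF _ _ g(2) tg] assms by auto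
  then have "g \<in> I x t" using interval_commute X assms by blast
  then show ?thesis using interval_chain(2)[OF _ _ t3] X assms g_def by blast
qed

text \<open>The gate of \<open>h\<close> in \<open>I x y\<close> lies in \<open>I h g\<close> and
  \<open>I h w\<close>, hence in \<open>I h (m h g w)\<close>, which is the singleton of
  \<open>h\<close>.\<close>

lemma interval_convex:
  assumes "x \<in> X" "y \<in> X" "g \<in> I x y" "w \<in> I x y" "h \<in> I g w"
  shows "h \<in> I x y"
proof -
  have X: "g \<in> X" "w \<in> X" "h \<in> X" using assms in_carrier by auto
  have "m h x y \<in> I h g" "m h x y \<in> I h w" using gate assms X by auto
  moreover have "m h g w = h" using assms X interval_eq[OF assms(5)] median_permute(3)[of h g w] by simp
  ultimately have "m h x y \<in> I h h" using interval_meet[of h g w "m h x y"] X by simp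
  then have "m h x y = h" using interval_singleton X by blast
  then show ?thesis using median_in_interval(2)[of h x y] X assms by simp
qed

lemma median_convex_interval: "\<lbrakk>x \<in> X; y \<in> X\<rbrakk> \<Longrightarrow> median_convex X m (I x y)"
  unfolding median_convex_def
  by (intro conjI subsetI ballI) (erule in_carrier, erule interval_convex[rotated 4], assumption+)

section \<open>Projections onto intervals and the distributive law\<close>

text \<open>\<open>m p q\<close> is the gate map onto \<open>I p q\<close>. The median
  \<open>u\<close> of \<open>P x\<close>, \<open>P y\<close> and \<open>z\<close> lies in the target
  interval, so it suffices that \<open>u = P z\<close>. The gate property gives that
  \<open>P z\<close> is in \<open>I z u\<close>; the reverse relation and antisymmetry at
  \<open>z\<close> finish.\<close>

lemma median_projection_interval:
  assumes "p \<in> X" "q \<in> X" "x \<in> X" "y \<in> X" "z \<in> I x y"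
  shows "m p q z \<in> I (m p q x) (m p q y)"
proof -
  define P where "P = m p q"
  have z: "z \<in> X" using assms in_carrier by auto
  have PX: "P v \<in> X" and PI: "P v \<in> I p q" if "v \<in> X" for v
    using that assms closed P_def median_in_interval by auto
  have Pg: "P v \<in> I v c" if "v \<in> X" "c \<in> I p q" for v c
    using gate[of v p q c] that assms median_permute(3)[of v p q] P_def by simp
  define u where "u = m (P x) (P y) z"
  have uX: "u \<in> X" using u_def PX assms z closed by simp
  have uI: "u \<in> I (P x) (P y)" "u \<in> I z (P x)" "u \<in> I z (P y)"
    using u_def PX assms z median_in_interval by auto
  have uC: "u \<in> I p q" using interval_convex[OF _ _ PI PI uI(1)] assms by auto
  have zu: "P z \<in> I z u" using Pg z uC by simp
  \<comment> \<open>Since \<open>w\<close> lies in \<open>I p q\<close>, the gate \<open>P v\<close>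
    is between \<open>v\<close> and \<open>w\<close>. So \<open>w\<close> is between
    \<open>u\<close> and each of \<open>P z\<close>, \<open>P v\<close>, while \<open>u\<close> is
    between these two; this forces \<open>w = u\<close>.\<close>
  have up: "u \<in> I (P z) v" if v: "v \<in> X" "u \<in> I z (P v)" for v
  proof -
    have uz: "u \<in> I (P z) (P v)" using interval_chain(1)[OF _ _ v(2) zu] z PX v by simp
    define w where "w = m v (P z) u"
    have wX: "w \<in> X" using w_def v PX z uX closed by simp
    have w: "w \<in> I v u" "w \<in> I (P z) u" "w \<in> I u (P z)"
      using w_def v PX z uX median_in_interval by auto
    have wC: "w \<in> I p q" using interval_convex[OF _ _ PI uC w(2)] assms z by simp
    have "w \<in> I (P v) u"
      using interval_chain(1)[OF _ _ w(1) Pg[OF _ wC]] v uX by simp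
    then have "w \<in> I u (P v)" using interval_commute PX v uX by simp
    then have "w \<in> I u (m u (P z) (P v))" using interval_meet w(3) uX PX z v by simp
    moreover have "m u (P z) (P v) = u" using interval_eq[OF uz] median_permute(3)[of u "P z" "P v"] PX uX z v by simp
    ultimately have "w = u" using interval_singleton uX by simp
    then show ?thesis
      using w_def median_permute(2)[of v "P z" u] v PX z uX by (simp add: interval_iff)
  qed
  \<comment> \<open>Using \<open>up\<close> for both endpoints, \<open>u\<close> is below the gate
    of \<open>P z\<close> in \<open>I x y\<close>, and that interval contains
    \<open>z\<close>.\<close>
  have "u \<in> I (P z) (m (P z) x y)"
    using interval_meet up uI assms PX z by simp
  moreover have "m (P z) x y \<in> I (P z) z" using gate assms PX z by simp
  ultimately have "u \<in> I (P z) z" using interval_chain(2) PX z by blast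
  then have "u \<in> I z (P z)" using interval_commute PX z by simp
  then have "u = P z" using interval_antisym[OF z zu] by simp
  then show ?thesis using uI P_def by simp
qed

text \<open>The image of the median lies in all three intervals between the images, and only one
  point does.\<close>

lemma median_projection:
  assumes "p \<in> X" "q \<in> X" "x \<in> X" "y \<in> X" "z \<in> X"
  shows "m p q (m x y z) = m (m p q x) (m p q y) (m p q z)"
proof (rule median_unique)
  show "m p q x \<in> X" "m p q y \<in> X" "m p q z \<in> X" using assms closed by simp_all
  show "m p q (m x y z) \<in> I (m p q x) (m p q y)" "m p q (m x y z) \<in> I (m p q y) (m p q z)"
    "m p q (m x y z) \<in> I (m p q x) (m p q z)"
    by (rule median_projection_interval median_in_interval assms)+
qed

text \<open>The median of \<open>u\<close>, \<open>v\<close> and \<open>z\<close> already lies in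
  \<open>I p q\<close>, so the projection fixes it; \<open>median_projection\<close> then moves the
  projection in and out.\<close>

theorem median_distrib:
  assumes "p \<in> X" "q \<in> X" "x \<in> X" "y \<in> X" "z \<in> X"
  shows "m p q (m x y z) = m (m p q x) (m p q y) z"
proof -
  define u v where "u = m p q x" and "v = m p q y"
  have uv: "u \<in> X" "v \<in> X" "u \<in> I p q" "v \<in> I p q"
    unfolding u_def v_def by (intro closed median_in_interval assms)+
  have "m u v z \<in> I u v" by (intro median_in_interval uv assms)
  then have "m u v z \<in> I p q" using interval_convex[OF assms(1,2) uv(3,4)] by simp
  then have "m u v z = m p q (m u v z)" by (simp add: interval_eq)
  also have "\<dots> = m (m p q u) (m p q v) (m p q z)"
    by (intro median_projection uv assms)
  also have "\<dots> = m u v (m p q z)" using uv by (simp add: interval_eq)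
  also have "\<dots> = m p q (m x y z)"
    unfolding u_def v_def by (intro median_projection[symmetric] assms)
  finally show ?thesis unfolding u_def v_def by simp
qed

section \<open>Cubes from pairwise crossing halfspaces\<close>


lemma convexD: "\<lbrakk>median_convex X m C; x \<in> C; y \<in> C; z \<in> I x y\<rbrakk> \<Longrightarrow> z \<in> C"
  unfolding median_convex_def by blast

lemma median_in_convex:
  assumes "median_convex X m C" "x \<in> X" "y \<in> X" "z \<in> X"
    and "x \<in> C \<and> y \<in> C \<or> y \<in> C \<and> z \<in> C \<or> x \<in> C \<and> z \<in> C"
  shows "m x y z \<in> C"
  using assms(5) convexD[OF assms(1)] median_in_interval[OF assms(2-4)] by blast

lemma median_convex_Int:
  "\<lbrakk>median_convex X m A; median_convex X m B\<rbrakk> \<Longrightarrow> median_convex X m (A \<inter> B)"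
  unfolding median_convex_def by blast

text \<open>The median of one point from each pairwise intersection lies in all three sets.\<close>

lemma helly3:
  assumes "median_convex X m A" "median_convex X m B" "median_convex X m C"
    and "A \<inter> B \<noteq> {}" "B \<inter> C \<noteq> {}" "A \<inter> C \<noteq> {}"
  shows "A \<inter> B \<inter> C \<noteq> {}"
proof -
  obtain x y z where xyz: "x \<in> A \<inter> B" "y \<in> B \<inter> C" "z \<in> A \<inter> C" using assms by blast
  then have X: "x \<in> X" "y \<in> X" "z \<in> X" using assms unfolding median_convex_def by auto
  have "m x y z \<in> A" "m x y z \<in> B" "m x y z \<in> C"
    using median_in_convex X xyz assms(1-3) by auto
  then show ?thesis by blast
qed

text \<open>The induction intersects every earlier set with the last one; \<open>helly3\<close>
  keeps the new sets pairwise intersecting.\<close>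

lemma helly:
  fixes C :: "nat \<Rightarrow> 'a set"
  assumes "\<And>i. i \<le> n \<Longrightarrow> median_convex X m (C i)"
    and "\<And>i j. \<lbrakk>i \<le> n; j \<le> n\<rbrakk> \<Longrightarrow> C i \<inter> C j \<noteq> {}"
  shows "\<exists>x. \<forall>i\<le>n. x \<in> C i"
  using assms
proof (induction n arbitrary: C)
  case 0
  then show ?case by fastforce
next
  case (Suc n)
  have "(C i \<inter> C (Suc n)) \<inter> (C j \<inter> C (Suc n)) \<noteq> {}" if "i \<le> n" "j \<le> n" for i j
    using helly3[of "C i" "C j" "C (Suc n)"] Suc.prems that by fastforce
  then have "\<exists>x. \<forall>i\<le>n. x \<in> C i \<inter> C (Suc n)"
    using Suc.prems(1) median_convex_Int by (intro Suc.IH) simp_all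
  then show ?case using le_Suc_eq by auto
qed

section \<open>Finite joins in an interval\<close>

text \<open>The bound is the join of \<open>F\<close> in the lattice \<open>I a b\<close>. Its
  membership in convex sets later keeps it outside halfspaces.\<close>

lemma interval_upper_bound:
  assumes "finite F" "a \<in> X" "b \<in> X" "F \<subseteq> I a b"
  shows "\<exists>c\<in>I a b. (\<forall>x\<in>F. x \<in> I a c) \<and>
    (\<forall>C. median_convex X m C \<and> a \<in> C \<and> F \<subseteq> C \<longrightarrow> c \<in> C)"
  using assms(1,4)
proof (induction F)
  case empty
  then show ?case using interval_endpoints assms by (intro bexI[of _ a]) auto
next
  case (insert x F)
  then obtain c where c: "c \<in> I a b" "\<And>x. x \<in> F \<Longrightarrow> x \<in> I a c"
    and cC: "\<And>C. median_convex X m C \<and> a \<in> C \<and> F \<subseteq> C \<Longrightarrow> c \<in> C"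
    by auto
  have x: "x \<in> I a b" using insert by simp
  have X: "c \<in> X" "x \<in> X" using c x in_carrier by auto
  let ?d = "m b c x"
  have dX: "?d \<in> X" using X assms closed by simp
  have d: "?d \<in> I a b"
    by (rule median_in_convex[OF median_convex_interval[OF assms(2,3)] assms(3) X])
      (use c x in blast)
  \<comment> \<open>The order based at \<open>b\<close> reverses the one based at \<open>a\<close>,
    so the meet \<open>m b\<close> at \<open>b\<close> is a join at \<open>a\<close>.\<close>
  have up: "y \<in> I a ?d" if y: "y \<in> I a b" "?d \<in> I b y" for y
    using interval_chain(1)[OF assms(3,2) interval_commute[OF assms(2,3) y(1)] y(2)]
    by (rule interval_commute[OF dX assms(2)])
  have cd: "c \<in> I a ?d" by (rule up[OF c(1) median_in_interval(1)[OF assms(3) X]])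
  have xd: "x \<in> I a ?d" by (rule up[OF x median_in_interval(3)[OF assms(3) X]])
  have "\<forall>y\<in>insert x F. y \<in> I a ?d"
    using interval_chain(2)[OF assms(2) dX cd] c(2) xd by blast
  moreover have "\<forall>C. median_convex X m C \<and> a \<in> C \<and> insert x F \<subseteq> C \<longrightarrow> ?d \<in> C"
    using cC median_in_convex[OF _ assms(3) X] by blast
  ultimately show ?case using d by blast
qed

text \<open>The join of \<open>a\<close> and the \<open>e i\<close> with \<open>i \<in> S\<close>, \<open>i < n\<close>, in the lattice \<open>I a b\<close> with bottom
  \<open>a\<close>, top \<open>b\<close>, meet \<open>m a\<close> and join \<open>m b\<close>.\<close>

primrec interval_join :: "'a \<Rightarrow> 'a \<Rightarrow> (nat \<Rightarrow> 'a) \<Rightarrow> nat \<Rightarrow> nat set \<Rightarrow> 'a" where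
  "interval_join a b e 0 S = a"
| "interval_join a b e (Suc n) S =
     (if n \<in> S then m b (e n) (interval_join a b e n S) else interval_join a b e n S)"

lemma interval_join_in:
  "\<lbrakk>a \<in> X; b \<in> X; \<And>i. i < n \<Longrightarrow> e i \<in> I a b\<rbrakk> \<Longrightarrow> interval_join a b e n S \<in> I a b"
proof (induction n)
  case (Suc n)
  then have "interval_join a b e n S \<in> I a b" "e n \<in> I a b" by auto
  moreover from this have "m b (e n) (interval_join a b e n S) \<in> I a b"
    by (intro median_in_convex[OF median_convex_interval] Suc.prems)
      (use in_carrier[OF Suc.prems(3)[of n]] in_carrier Suc.prems(3)[of n] in auto)
  ultimately show ?case by simp
qed (simp add: interval_endpoints)

lemma interval_join_cong:
  "S \<inter> {..<n} = T \<inter> {..<n} \<Longrightarrow> interval_join a b e n S = interval_join a b e n T"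
proof (induction n)
  case (Suc n)
  have "S \<inter> {..<n} = T \<inter> {..<n}" "n \<in> S \<longleftrightarrow> n \<in> T"
    using Suc.prems by (auto simp: set_eq_iff less_Suc_eq)
  then show ?case using Suc.IH by simp
qed simp

text \<open>A meet with \<open>x\<close> distributes over joins, because \<open>m a x\<close> is a
  median-preserving projection.\<close>

lemma interval_join_disjoint:
  assumes "a \<in> X" "b \<in> X" "x \<in> I a b" "\<And>i. i < n \<Longrightarrow> e i \<in> I a b"
    and "\<And>i. i < n \<Longrightarrow> m a x (e i) = a"
  shows "m a x (interval_join a b e n S) = a"
  using assms(4,5)
proof (induction n)
  case 0
  have "x \<in> X" using assms in_carrier by auto
  then show ?case using majority[of x a] median_permute(2)[of x a a] assms by simp
next
  case (Suc n)
  let ?u = "interval_join a b e n S"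
  have X: "x \<in> X" "e n \<in> X" "?u \<in> X"
    using assms(3) Suc.prems(1) in_carrier in_carrier[OF interval_join_in] assms(1,2) by auto
  have "m a x b = x" using interval_eq[OF assms(3)] median_permute(1)[of a b x] X assms by simp
  then have "m a x (m b (e n) ?u) = m x a a"
    using median_projection[of a x b "e n" ?u] Suc X assms(1,2) by simp
  then show ?case using Suc X assms(1) majority by simp
qed

text \<open>Joins of pairwise disjoint elements turn the majority operation on index sets into the
  median. The induction step splits by how many of \<open>S\<close>, \<open>T\<close>,
  \<open>U\<close> contain \<open>n\<close>: three is \<open>median_projection\<close>, two is
  \<open>median_distrib\<close>, one uses disjointness.\<close>

lemma median_interval_join:
  assumes "a \<in> X" "b \<in> X" "\<And>i. i < n \<Longrightarrow> e i \<in> I a b"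
    and "\<And>i j. \<lbrakk>i < n; j < n; i \<noteq> j\<rbrakk> \<Longrightarrow> m a (e i) (e j) = a"
  shows "m (interval_join a b e n S) (interval_join a b e n T) (interval_join a b e n U) =
    interval_join a b e n (S \<inter> T \<union> T \<inter> U \<union> S \<inter> U)"
  using assms(3,4)
proof (induction n)
  case 0
  then show ?case using majority assms by simp
next
  case (Suc n)
  let ?J = "interval_join a b e n"
  define f where "f = e n"
  have f: "f \<in> I a b" "f \<in> X" using Suc.prems(1) in_carrier f_def by auto
  have JX: "?J S \<in> X" for S
    using in_carrier[OF interval_join_in] Suc.prems(1) in_carrier assms by simp
  have dis: "m a f (?J S) = a" for S
    unfolding f_def using interval_join_disjoint Suc.prems assms by simp
  have IH: "m (?J S) (?J T) (?J U) = ?J (S \<inter> T \<union> T \<inter> U \<union> S \<inter> U)"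
    using Suc.IH Suc.prems by simp
  have two: "m (m b f u) (m b f v) w = m b f (m u v w)" if "u \<in> X" "v \<in> X" "w \<in> X" for u v w
    using median_distrib[of b f u v w] that f assms by simp
  have three: "m (m b f u) (m b f v) (m b f w) = m b f (m u v w)"
    if "u \<in> X" "v \<in> X" "w \<in> X" for u v w
    using median_projection[of b f u v w] that f assms by simp
  \<comment> \<open>As \<open>a\<close> lies between \<open>f\<close> and each of \<open>v\<close>,
    \<open>w\<close>, the medians \<open>m v w a\<close> and \<open>m v w f\<close> agree. So
    \<open>f\<close> may be replaced by the bottom \<open>a\<close>, and joining with
    \<open>a\<close> changes nothing.\<close>
  have one: "m (m b f (?J S)) (?J T) (?J U) = m (?J S) (?J T) (?J U)" for S T U
  proof -
    define u v w where "u = ?J S" and "v = ?J T" and "w = ?J U"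
    have X: "u \<in> X" "v \<in> X" "w \<in> X" using JX u_def v_def w_def by auto
    have avw: "a \<in> I f v" "a \<in> I f w"
      using dis[of T] dis[of U] v_def w_def median_permute(3)[of a f v] median_permute(3)[of a f w]
        X f assms
      by (simp_all add: interval_iff)
    have k: "m v w a \<in> X" "m v w a \<in> I v w" "m v w a \<in> I a v" "m v w a \<in> I a w"
      using median_in_interval[of v w a] closed X assms by auto
    have ka: "m v w a \<in> I v a" "m v w a \<in> I w a" using interval_commute k X assms by auto
    have ac: "a \<in> I v f" "a \<in> I w f" using avw interval_commute X f by auto
    have "m v w a = m v w f"
      using median_unique[of v w f "m v w a"] interval_chain(2)[OF _ _ ac(1) ka(1)]
        interval_chain(2)[OF _ _ ac(2) ka(2)] k X f by simp
    moreover have "m v w (m b f u) = m (m v w b) (m v w f) u"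
      "m v w (m b a u) = m (m v w b) (m v w a) u"
      using median_distrib X f assms by simp_all
    moreover have "m b a u = u"
      using interval_eq[OF interval_join_in[of a b n e S]] median_permute(2)[of a b u] u_def X Suc.prems assms
      by simp
    ultimately have "m v w (m b f u) = m v w u" by simp
    then show ?thesis
      using median_permute(3)[of "m b f u" v w] median_permute(3)[of u v w] closed X f assms
        u_def v_def w_def by simp
  qed
  have bX: "m b f (?J S) \<in> X" for S using closed JX f assms by simp
  have oneb: "m (?J S) (m b f (?J T)) (?J U) = m (?J S) (?J T) (?J U)" for S T U
    by (simp only: swap12[OF JX bX JX, of S T U] one swap12[OF JX JX JX, of T S U])
  have onec: "m (?J S) (?J T) (m b f (?J U)) = m (?J S) (?J T) (?J U)" for S T U
    by (simp only: swap23[OF JX JX bX, of S T U] oneb swap23[OF JX JX JX, of S U T])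
  have twob: "m (m b f (?J S)) (?J T) (m b f (?J U)) = m b f (m (?J S) (?J T) (?J U))" for S T U
    by (simp only: swap23[OF bX JX bX, of S T U] two[OF JX JX JX] swap23[OF JX JX JX, of S U T])
  have twoc: "m (?J S) (m b f (?J T)) (m b f (?J U)) = m b f (m (?J S) (?J T) (?J U))" for S T U
    by (simp only: swap12[OF JX bX bX, of S T U] twob swap12[OF JX JX JX, of T S U])
  show ?case
    unfolding interval_join.simps f_def[symmetric]
    by (cases "n \<in> S"; cases "n \<in> T"; cases "n \<in> U")
      (simp_all add: one oneb onec two[OF JX JX JX] twob twoc three[OF JX JX JX] IH)
qed

section \<open>Cubes spanned by crossing halfspaces\<close>

text \<open>The indicator of a halfspace preserves medians: two of the three points lie on one side,
  which is convex.\<close>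

lemma median_in_halfspace_iff:
  assumes "median_halfspace X m H" "x \<in> X" "y \<in> X" "z \<in> X"
  shows "m x y z \<in> H \<longleftrightarrow> x \<in> H \<and> y \<in> H \<or> y \<in> H \<and> z \<in> H \<or> x \<in> H \<and> z \<in> H"
proof -
  have "median_convex X m H" "median_convex X m (X - H)"
    using assms(1) unfolding median_halfspace_def by auto
  from median_in_convex[OF this(1) assms(2-4)] median_in_convex[OF this(2) assms(2-4)]
  show ?thesis using assms(2-4) by blast
qed

text \<open>Crossing says that any choice of sides meets pairwise, so Helly's theorem yields a
  common point.\<close>

lemma crossing_halfspaces_pattern:
  fixes H :: "nat \<Rightarrow> 'a set"
  assumes hs: "\<And>i. i \<le> n \<Longrightarrow> median_halfspace X m (H i)"
    and cr: "\<And>i j. \<lbrakk>i \<le> n; j \<le> n; i \<noteq> j\<rbrakk> \<Longrightarrow> crossing X (H i) (H j)"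
  shows "\<exists>x\<in>X. \<forall>i\<le>n. x \<in> H i \<longleftrightarrow> i \<in> S"
proof -
  define C where "C i = (if i \<in> S then H i else X - H i)" for i
  have "\<exists>x. \<forall>i\<le>n. x \<in> C i"
  proof (rule helly)
    show "median_convex X m (C i)" if "i \<le> n" for i
      using hs[OF that] unfolding C_def median_halfspace_def by simp
    show "C i \<inter> C j \<noteq> {}" if "i \<le> n" "j \<le> n" for i j
    proof (cases "i = j")
      case True
      then show ?thesis using hs[OF that(1)] unfolding C_def median_halfspace_def by simp
    next
      case False
      then show ?thesis using cr[OF that False] unfolding C_def crossing_def by simp
    qed
  qed
  then obtain x where x: "\<forall>i\<le>n. x \<in> C i" by blast
  have "C 0 \<subseteq> X" using hs[of 0] unfolding C_def median_halfspace_def median_convex_def by simp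
  moreover have "x \<in> C 0" using x by simp
  moreover have "\<forall>i\<le>n. x \<in> H i \<longleftrightarrow> i \<in> S"
    using x unfolding C_def by (auto split: if_splits)
  ultimately show ?thesis by blast
qed

text \<open>With \<open>b\<close> in \<open>H\<close>, membership in \<open>H\<close> turns the join
  \<open>m b\<close> into a disjunction.\<close>

lemma interval_join_in_halfspace_iff:
  assumes "median_halfspace X m H" "a \<in> X" "b \<in> X" "a \<notin> H" "b \<in> H"
    and "\<And>i. i < n \<Longrightarrow> e i \<in> I a b" "\<And>i. i < n \<Longrightarrow> e i \<in> H \<longleftrightarrow> i = k"
  shows "interval_join a b e n S \<in> H \<longleftrightarrow> k < n \<and> k \<in> S"
  using assms(6,7)
proof (induction n)
  case (Suc n)
  let ?u = "interval_join a b e n S"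
  have "?u \<in> X" "e n \<in> X"
    using in_carrier[OF interval_join_in[of a b n e S]] in_carrier[OF Suc.prems(1)[of n]]
      Suc.prems(1) assms(2,3) by simp_all
  then have "m b (e n) ?u \<in> H \<longleftrightarrow> e n \<in> H \<or> ?u \<in> H"
    using median_in_halfspace_iff[OF assms(1,3)] assms(5) by blast
  then show ?case using Suc by (auto simp: less_Suc_eq)
qed (simp add: assms)

text \<open>The points \<open>e i\<close> will be the atoms of the cube, \<open>c\<close> its
  bottom; each \<open>H k\<close> contains exactly one atom.\<close>

lemma crossing_halfspaces_atoms:
  fixes H :: "nat \<Rightarrow> 'a set"
  assumes hs: "\<And>i. i \<le> n \<Longrightarrow> median_halfspace X m (H i)"
    and cr: "\<And>i j. \<lbrakk>i \<le> n; j \<le> n; i \<noteq> j\<rbrakk> \<Longrightarrow> crossing X (H i) (H j)"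
  shows "\<exists>c b e. c \<in> X \<and> b \<in> X \<and> (\<forall>i\<le>n. e i \<in> I c b) \<and>
    (\<forall>i\<le>n. \<forall>j\<le>n. i \<noteq> j \<longrightarrow> m c (e i) (e j) = c) \<and>
    (\<forall>k\<le>n. c \<notin> H k \<and> b \<in> H k \<and> (\<forall>i\<le>n. e i \<in> H k \<longleftrightarrow> i = k))"
proof -
  obtain a where a: "a \<in> X" "\<And>i. i \<le> n \<Longrightarrow> a \<notin> H i"
    using crossing_halfspaces_pattern[of n H "{}"] hs cr by blast
  obtain b where b: "b \<in> X" "\<And>i. i \<le> n \<Longrightarrow> b \<in> H i"
    using crossing_halfspaces_pattern[of n H UNIV] hs cr by blast
  have "\<forall>i. \<exists>x\<in>X. \<forall>k\<le>n. x \<in> H k \<longleftrightarrow> k = i"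
    using crossing_halfspaces_pattern[of n H "{i}" for i] hs cr by simp
  then obtain x where x: "\<And>i. x i \<in> X" "\<And>i k. k \<le> n \<Longrightarrow> x i \<in> H k \<longleftrightarrow> k = i"
    by metis
  \<comment> \<open>\<open>a\<close> and \<open>b\<close> disagree about every \<open>H k\<close>,
    so projecting to \<open>I a b\<close> preserves the membership pattern of
    \<open>x i\<close>.\<close>
  define y where "y i = m a b (x i)" for i
  have yX: "y i \<in> X" for i unfolding y_def by (intro closed a b x)
  have yI: "y i \<in> I a b" for i unfolding y_def by (intro median_in_interval a b x)
  have yH: "y i \<in> H k \<longleftrightarrow> k = i" if "k \<le> n" for i k
    unfolding y_def using median_in_halfspace_iff[OF hs[OF that] a(1) b(1) x(1)] a b x that by blast
  define F where "F = (\<lambda>(i, j). m a (y i) (y j)) ` {(i, j). i \<le> n \<and> j \<le> n \<and> i \<noteq> j}"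
  have "finite {(i, j). i \<le> n \<and> j \<le> n \<and> i \<noteq> j}"
    by (rule finite_subset[of _ "{..n} \<times> {..n}"]) auto
  then have "finite F" unfolding F_def by simp
  moreover have "F \<subseteq> I a b"
    unfolding F_def
    using median_in_convex[OF median_convex_interval[OF a(1) b(1)] a(1) yX yX] yI by auto
  ultimately obtain c where c: "c \<in> I a b" "\<And>z. z \<in> F \<Longrightarrow> z \<in> I a c"
    and cC: "\<And>C. \<lbrakk>median_convex X m C; a \<in> C; F \<subseteq> C\<rbrakk> \<Longrightarrow> c \<in> C"
    using interval_upper_bound[of F a b] a(1) b(1) by blast
  have cX: "c \<in> X" using c(1) by (rule in_carrier)
  have cH: "c \<notin> H k" if k: "k \<le> n" for k
  proof -
    \<comment> \<open>At least two of the three arguments lie outside \<open>H k\<close>.\<close>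
    have "m a (y i) (y j) \<in> X - H k" if "i \<noteq> j" for i j
      using median_in_halfspace_iff[OF hs[OF k] a(1) yX yX, of i j] closed[OF a(1) yX yX, of i j]
        a(2)[OF k] yH[OF k] that by auto
    then have "F \<subseteq> X - H k" unfolding F_def by auto
    then have "c \<in> X - H k"
      using cC[of "X - H k"] hs[OF k] a k unfolding median_halfspace_def by blast
    then show ?thesis by blast
  qed
  define e where "e i = m b c (y i)" for i
  have eI: "e i \<in> I c b" for i unfolding e_def by (intro median_in_interval b cX yX)
  have eH: "e i \<in> H k \<longleftrightarrow> i = k" if "k \<le> n" for i k
    unfolding e_def
    using median_in_halfspace_iff[OF hs[OF that] b(1) cX yX] b(2)[OF that] cH[OF that]
      yH[OF that, of i] by auto
  \<comment> \<open>Joining with \<open>c\<close> is the projection \<open>m b c\<close>. It sends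
    \<open>a\<close> to \<open>c\<close>, and it sends the meet of \<open>y i\<close> and
    \<open>y j\<close> to \<open>c\<close> because this meet is below \<open>c\<close>.\<close>
  have "m c (e i) (e j) = c" if "i \<le> n" "j \<le> n" "i \<noteq> j" for i j
  proof -
    have mF: "m a (y i) (y j) \<in> I a c" by (rule c(2)) (use that in \<open>auto simp: F_def\<close>)
    have "c \<in> I (m a (y i) (y j)) b" by (rule interval_chain(1)[OF a(1) b(1) c(1) mF])
    then have "m b c (m a (y i) (y j)) = c"
      using interval_eq[of c "m a (y i) (y j)" b] median_permute(4)[of b c "m a (y i) (y j)"]
        median_permute(1)[of "m a (y i) (y j)" c b] closed[OF a(1) yX yX, of i j] b(1) cX by simp
    moreover have "m b c a = c"
      using interval_eq[OF c(1)] median_permute(3)[of a b c] a(1) b(1) cX by simp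
    ultimately show ?thesis
      using median_projection[OF b(1) cX a(1) yX yX, of i j] unfolding e_def by simp
  qed
  then show ?thesis
    by (intro exI[of _ c] exI[of _ b] exI[of _ e] conjI allI impI cX b eI cH eH)
qed

text \<open>A vertex is sent to the join of the atoms at its coordinates equal to 1. The indices run
  from 0 to \<open>n\<close>, hence the dimension \<open>Suc n\<close>.\<close>

lemma crossing_halfspaces_cube_embeds:
  fixes H :: "nat \<Rightarrow> 'a set"
  assumes hs: "\<And>i. i \<le> n \<Longrightarrow> median_halfspace X m (H i)"
    and cr: "\<And>i j. \<lbrakk>i \<le> n; j \<le> n; i \<noteq> j\<rbrakk> \<Longrightarrow> crossing X (H i) (H j)"
  shows "cube_embeds X m (Suc n)"
proof -
  obtain c b e where cb: "c \<in> X" "b \<in> X" and e: "\<forall>i\<le>n. e i \<in> I c b"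
    and dis: "\<forall>i\<le>n. \<forall>j\<le>n. i \<noteq> j \<longrightarrow> m c (e i) (e j) = c"
    and H: "\<forall>k\<le>n. c \<notin> H k \<and> b \<in> H k \<and> (\<forall>i\<le>n. e i \<in> H k \<longleftrightarrow> i = k)"
    using crossing_halfspaces_atoms[of n H, OF hs cr] by blast
  let ?J = "interval_join c b e (Suc n)"
  define \<phi> where "\<phi> u = ?J {i. u i = (1::real)}" for u
  have "?J S \<in> X" for S
    by (rule in_carrier[OF interval_join_in[OF cb]]) (simp add: e)
  then have "\<phi> \<in> cube (Suc n) \<rightarrow> X" unfolding \<phi>_def by blast
  moreover have "\<phi> (cube_median (Suc n) u v w) = m (\<phi> u) (\<phi> v) (\<phi> w)"
    if "u \<in> cube (Suc n)" "v \<in> cube (Suc n)" "w \<in> cube (Suc n)" for u v w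
  proof -
    have "cube_median (Suc n) u v w i = 1 \<longleftrightarrow>
      u i = 1 \<and> v i = 1 \<or> v i = 1 \<and> w i = 1 \<or> u i = 1 \<and> w i = 1" if i: "i < Suc n" for i
    proof -
      have "u i \<in> {0, 1}" "v i \<in> {0, 1}" "w i \<in> {0, 1}"
        using \<open>u \<in> _\<close> \<open>v \<in> _\<close> \<open>w \<in> _\<close> i unfolding cube_def by (auto dest: PiE_mem)
      then show ?thesis using i by (auto simp: cube_median_def real_median_def)
    qed
    \<comment> \<open>The two index sets need only agree below \<open>Suc n\<close>; beyond that,
      cube points have the value \<open>undefined\<close>.\<close>
    then have "\<phi> (cube_median (Suc n) u v w) = ?J ({i. u i = 1} \<inter> {i. v i = 1} \<union>
      {i. v i = 1} \<inter> {i. w i = 1} \<union> {i. u i = 1} \<inter> {i. w i = 1})"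
      unfolding \<phi>_def by (intro interval_join_cong) auto
    moreover have "m (?J S) (?J T) (?J U) = ?J (S \<inter> T \<union> T \<inter> U \<union> S \<inter> U)" for S T U
      by (rule median_interval_join[OF cb]) (simp_all add: e dis)
    ultimately show ?thesis unfolding \<phi>_def by (simp only:)
  qed
  moreover have "inj_on \<phi> (cube (Suc n))"
  proof (rule inj_onI)
    fix u v assume uv: "u \<in> cube (Suc n)" "v \<in> cube (Suc n)" "\<phi> u = \<phi> v"
    \<comment> \<open>The halfspace \<open>H k\<close> reads off coordinate
      \<open>k\<close>.\<close>
    have mem: "\<phi> w \<in> H k \<longleftrightarrow> w k = 1" if "k \<le> n" for w k
      unfolding \<phi>_def
      using interval_join_in_halfspace_iff[OF hs[OF that] cb, of "Suc n" e k] e H that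
      by (simp del: interval_join.simps)
    show "u = v"
    proof (rule PiE_ext)
      show "u \<in> {..<Suc n} \<rightarrow>\<^sub>E {0, 1}" "v \<in> {..<Suc n} \<rightarrow>\<^sub>E {0, 1}"
        using uv unfolding cube_def by auto
      then have "u k \<in> {0, 1}" "v k \<in> {0, 1}" if "k < Suc n" for k
        using that by (auto dest: PiE_mem)
      moreover have "u k = 1 \<longleftrightarrow> v k = 1" if "k < Suc n" for k
        using mem[of k u] mem[of k v] uv(3) that by simp
      ultimately show "u k = v k" if "k \<in> {..<Suc n}" for k
        using that by fastforce
    qed
  qed
  ultimately show ?thesis
    unfolding cube_embeds_def median_preserving_def by (intro exI[of _ \<phi>] conjI ballI)
qed

text \<open>Finite initial pieces of an infinite crossing family embed cubes of every positive
  dimension.\<close>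

theorem finite_rank_imp_subinfinite_rank:
  assumes "finite_rank X m"
  shows "subinfinite_rank X m"
  unfolding subinfinite_rank_def
proof (intro allI impI, rule ccontr)
  fix \<H> assume H: "(\<forall>A\<in>\<H>. median_halfspace X m A) \<and> pairwise (crossing X) \<H>" "infinite \<H>"
  obtain h :: "nat \<Rightarrow> 'a set" where h: "inj h" "range h \<subseteq> \<H>"
    using infinite_countable_subset[OF H(2)] by blast
  have "cube_embeds X m (Suc n)" for n
  proof (rule crossing_halfspaces_cube_embeds)
    show "median_halfspace X m (h i)" for i using h H(1) by blast
    show "crossing X (h i) (h j)" if "i \<noteq> j" for i j
    proof (rule pairwiseD[of "crossing X" \<H>])
      show "pairwise (crossing X) \<H>" using H(1) by blast
      show "h i \<in> \<H>" "h j \<in> \<H>" using h(2) by auto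
      show "h i \<noteq> h j" using injD[OF h(1)] that by blast
    qed
  qed
  then have le: "enat (Suc n) \<le> median_rank X m" for n
    unfolding median_rank_def by (intro SUP_upper) simp
  have "median_rank X m \<noteq> \<infinity>" using assms unfolding finite_rank_def by simp
  then obtain k where "median_rank X m = enat k" by auto
  then show False using le[of k] by simp
qed

end

section \<open>Sequences of halfspaces and of median-preserving maps\<close>

text \<open>Pointwise convergence on \<open>X\<close> of the indicator functions.\<close>

definition set_convergent :: "'a set \<Rightarrow> (nat \<Rightarrow> 'a set) \<Rightarrow> bool" where
  "set_convergent X H \<longleftrightarrow>
     (\<forall>x\<in>X. (\<forall>\<^sub>F n in sequentially. x \<in> H n) \<or> (\<forall>\<^sub>F n in sequentially. x \<notin> H n))"

text \<open>The truth values \<open>b\<close> and \<open>c\<close> cover the four non-crossing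
  patterns at once. Either membership is \<open>b\<close> at some index and \<open>c\<close> from
  then on, or it is never \<open>b\<close>, hence constant.\<close>

lemma set_convergentI:
  assumes "\<And>i j x. \<lbrakk>i < j; x \<in> X; x \<in> H i \<longleftrightarrow> b\<rbrakk> \<Longrightarrow> x \<in> H j \<longleftrightarrow> c"
  shows "set_convergent X H"
proof -
  have "\<exists>k d. \<forall>n>k. x \<in> H n \<longleftrightarrow> d" if "x \<in> X" for x
  proof (cases "\<exists>k. x \<in> H k \<longleftrightarrow> b")
    case True
    then obtain k where "x \<in> H k \<longleftrightarrow> b" by blast
    then show ?thesis using assms that by (intro exI[of _ k] exI[of _ c]) blast
  next
    case False
    then have "\<forall>n>0. x \<in> H n \<longleftrightarrow> \<not> b" by blast
    then show ?thesis by blast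
  qed
  then show ?thesis unfolding set_convergent_def eventually_at_top_dense by (metis (full_types))
qed

definition crossing_type :: "'a set \<Rightarrow> 'a set \<Rightarrow> 'a set \<Rightarrow> nat" where
  "crossing_type X A B =
    (if crossing X A B then 0 else if A \<inter> B = {} then 1 else if A \<inter> (X - B) = {} then 2
     else if (X - A) \<inter> B = {} then 3 else 4)"

lemma crossing_type_less: "crossing_type X A B < 5"
  by (simp add: crossing_type_def)

text \<open>Type 4 means not crossing with the first three intersections nonempty, so the fourth
  must be empty.\<close>

lemma crossing_typeD:
  "crossing_type X A B = 0 \<Longrightarrow> crossing X A B"
  "crossing_type X A B = 1 \<Longrightarrow> A \<inter> B = {}"
  "crossing_type X A B = 2 \<Longrightarrow> A \<inter> (X - B) = {}"
  "crossing_type X A B = 3 \<Longrightarrow> (X - A) \<inter> B = {}"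
  "crossing_type X A B = 4 \<Longrightarrow> (X - A) \<inter> (X - B) = {}"
proof -
  have *: "(if p then 0 else if q then 1 else if r then 2 else if s then 3 else 4) = (k :: nat) \<Longrightarrow>
    (k = 0 \<longrightarrow> p) \<and> (k = 1 \<longrightarrow> q) \<and> (k = 2 \<longrightarrow> r) \<and> (k = 3 \<longrightarrow> s) \<and>
    (k = 4 \<longrightarrow> \<not> p \<and> \<not> q \<and> \<not> r \<and> \<not> s)" for p q r s k
    by (cases p; cases q; cases r; cases s) auto
  note ** = *[OF crossing_type_def[symmetric, of X A B]]
  show "crossing_type X A B = 0 \<Longrightarrow> crossing X A B"
    "crossing_type X A B = 1 \<Longrightarrow> A \<inter> B = {}"
    "crossing_type X A B = 2 \<Longrightarrow> A \<inter> (X - B) = {}"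
    "crossing_type X A B = 3 \<Longrightarrow> (X - A) \<inter> B = {}"
    using ** by blast+
  show "crossing_type X A B = 4 \<Longrightarrow> (X - A) \<inter> (X - B) = {}"
    using ** unfolding crossing_def by blast
qed

lemma ramsey_crossing_or_convergent:
  fixes H :: "nat \<Rightarrow> 'a set"
  shows "\<exists>r. strict_mono r \<and>
    ((\<forall>i j. i < j \<longrightarrow> crossing X (H (r i)) (H (r j))) \<or> set_convergent X (H \<circ> r))"
proof -
  define q where "q i j = crossing_type X (H i) (H j)" for i j
  \<comment> \<open>Ramsey's theorem colours unordered pairs, whereas inclusion depends on the
    order; \<open>Min\<close> and \<open>Max\<close> restore it.\<close>
  define c where "c Z = q (Min Z) (Max Z)" for Z
  have "\<exists>Y t. Y \<subseteq> UNIV \<and> infinite Y \<and> t < (5::nat) \<and> (\<forall>i\<in>Y. \<forall>j\<in>Y. i \<noteq> j \<longrightarrow> c {i, j} = t)"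
    by (rule Ramsey2) (simp_all add: c_def q_def crossing_type_less)
  then obtain Y t where Y: "infinite Y" "t < 5"
    and t: "\<And>i j. \<lbrakk>i \<in> Y; j \<in> Y; i \<noteq> j\<rbrakk> \<Longrightarrow> c {i, j} = t"
    by blast
  define r where "r = enumerate Y"
  have r: "strict_mono r" "\<And>i. r i \<in> Y"
    unfolding r_def using Y(1) by (simp_all add: strict_mono_enumerate enumerate_in_set)
  have qt: "q (r i) (r j) = t" if "i < j" for i j
  proof -
    have "r i < r j" using r(1) that by (rule strict_monoD)
    then have "c {r i, r j} = q (r i) (r j)" by (simp add: c_def)
    then show ?thesis using t[OF r(2) r(2), of i j] \<open>r i < r j\<close> by simp
  qed
  have "t = 0 \<or> t = 1 \<or> t = 2 \<or> t = 3 \<or> t = 4" using Y(2) by linarith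
  then consider (cross) "t = 0" | (disjoint) "t = 1" | (incr) "t = 2" | (decr) "t = 3" | (codisjoint) "t = 4"
    by blast
  then show ?thesis
  proof cases
    case cross
    then have "crossing X (H (r i)) (H (r j))" if "i < j" for i j
      using crossing_typeD(1)[of X "H (r i)" "H (r j)"] qt[OF that] by (simp add: q_def)
    then show ?thesis using r(1) by blast
  next
    case disjoint
    then have *: "H (r i) \<inter> H (r j) = {}" if "i < j" for i j
      using crossing_typeD(2)[of X "H (r i)" "H (r j)"] qt[OF that] by (simp add: q_def)
    have "set_convergent X (H \<circ> r)"
      by (rule set_convergentI[of _ _ True False]) (use * in \<open>simp; blast\<close>)
    then show ?thesis using r(1) by blast
  next
    case incr
    then have *: "H (r i) \<inter> (X - H (r j)) = {}" if "i < j" for i j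
      using crossing_typeD(3)[of X "H (r i)" "H (r j)"] qt[OF that] by (simp add: q_def)
    have "set_convergent X (H \<circ> r)"
      by (rule set_convergentI[of _ _ True True]) (use * in \<open>simp; blast\<close>)
    then show ?thesis using r(1) by blast
  next
    case decr
    then have *: "(X - H (r i)) \<inter> H (r j) = {}" if "i < j" for i j
      using crossing_typeD(4)[of X "H (r i)" "H (r j)"] qt[OF that] by (simp add: q_def)
    have "set_convergent X (H \<circ> r)"
      by (rule set_convergentI[of _ _ False False]) (use * in \<open>simp; blast\<close>)
    then show ?thesis using r(1) by blast
  next
    case codisjoint
    then have *: "(X - H (r i)) \<inter> (X - H (r j)) = {}" if "i < j" for i j
      using crossing_typeD(5)[of X "H (r i)" "H (r j)"] qt[OF that] by (simp add: q_def)
    have "set_convergent X (H \<circ> r)"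
      by (rule set_convergentI[of _ _ False True]) (use * in \<open>simp; blast\<close>)
    then show ?thesis using r(1) by blast
  qed
qed

text \<open>Convexity of both sides admits the empty set and \<open>X\<close>. In a crossing
  sequence the members are proper, hence halfspaces, and distinct because no set crosses itself; so
  there would be an infinite crossing family.\<close>

lemma subinfinite_rank_convergent_subseq:
  fixes H :: "nat \<Rightarrow> 'a set"
  assumes "subinfinite_rank X m"
    and "\<And>n. median_convex X m (H n)" "\<And>n. median_convex X m (X - H n)"
  shows "\<exists>r. strict_mono r \<and> set_convergent X (H \<circ> r)"
proof -
  obtain r where r: "strict_mono r"
    and alt: "(\<forall>i j. i < j \<longrightarrow> crossing X (H (r i)) (H (r j))) \<or> set_convergent X (H \<circ> r)"
    using ramsey_crossing_or_convergent[of X H] by blast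
  have "\<not> (\<forall>i j. i < j \<longrightarrow> crossing X (H (r i)) (H (r j)))"
  proof
    assume lt: "\<forall>i j. i < j \<longrightarrow> crossing X (H (r i)) (H (r j))"
    have cr: "crossing X (H (r i)) (H (r j))" if "i \<noteq> j" for i j
    proof (cases "i < j")
      case True
      then show ?thesis using lt by blast
    next
      case False
      then have "crossing X (H (r j)) (H (r i))" using lt that by simp
      then show ?thesis unfolding crossing_def by blast
    qed
    have "inj (H \<circ> r)"
    proof (rule injI, rule ccontr)
      fix i j assume "(H \<circ> r) i = (H \<circ> r) j" "i \<noteq> j"
      then show False using cr[of i j] unfolding crossing_def by auto
    qed
    then have "infinite (range (H \<circ> r))" using range_inj_infinite by blast
    moreover have "pairwise (crossing X) (range (H \<circ> r))"
    proof (rule pairwiseI)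
      fix A B assume "A \<in> range (H \<circ> r)" "B \<in> range (H \<circ> r)" "A \<noteq> B"
      then obtain i j where ij: "A = H (r i)" "B = H (r j)" by auto
      with \<open>A \<noteq> B\<close> have "i \<noteq> j" by blast
      then show "crossing X A B" unfolding ij by (rule cr)
    qed
    moreover have "median_halfspace X m (H (r i))" for i
      using cr[of i "Suc i"] assms(2,3) unfolding median_halfspace_def crossing_def by auto
    ultimately show False using assms(1) unfolding subinfinite_rank_def by fastforce
  qed
  then show ?thesis using alt r by blast
qed

section \<open>Real-valued maps and the diagonal argument\<close>

text \<open>On the interval between \<open>x\<close> and \<open>y\<close>, the values of
  \<open>f\<close> stay between \<open>f x\<close> and \<open>f y\<close>.\<close>

lemma median_preserving_ray_convex:
  assumes "median_preserving X m UNIV real_median f"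
  shows "median_convex X m {x \<in> X. f x < q}" "median_convex X m (X - {x \<in> X. f x < q})"
proof -
  have "f z = real_median (f x) (f y) (f z)"
    if "x \<in> X" "y \<in> X" "z \<in> median_interval X m x y" for x y z
    using assms that unfolding median_preserving_def median_interval_def by fastforce
  then have mid: "min (f x) (f y) \<le> f z \<and> f z \<le> max (f x) (f y)"
    if "x \<in> X" "y \<in> X" "z \<in> median_interval X m x y" for x y z
    using that unfolding real_median_def by (smt (verit))
  have "z \<in> X" if "z \<in> median_interval X m x y" for x y z
    using that unfolding median_interval_def by simp
  then show "median_convex X m {x \<in> X. f x < q}" "median_convex X m (X - {x \<in> X. f x < q})"
    unfolding median_convex_def using mid by fastforce+
qed

text \<open>Boundedness gives a subsequential limit \<open>l\<close>. For a rational
  \<open>q\<close> other than \<open>l\<close>, the subsequence decides on which side of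
  \<open>q\<close> the whole sequence finally stays.\<close>

lemma convergent_rational_rays:
  fixes u :: "nat \<Rightarrow> real"
  assumes "bounded (range u)"
    and "\<And>q. q \<in> \<rat> \<Longrightarrow> (\<forall>\<^sub>F n in sequentially. u n < q) \<or> (\<forall>\<^sub>F n in sequentially. \<not> u n < q)"
  shows "convergent u"
proof -
  obtain l s where s: "strict_mono s" "(u \<circ> s) \<longlonglongrightarrow> l"
    using bounded_imp_convergent_subsequence[OF assms(1)] by blast
  have "u \<longlonglongrightarrow> l"
  proof (rule order_tendstoI)
    fix a assume "a < l"
    then obtain q where q: "q \<in> \<rat>" "a < q" "q < l" using Rats_dense_in_real by blast
    have "\<not> (\<forall>\<^sub>F n in sequentially. u n < q)"
    proof
      assume "\<forall>\<^sub>F n in sequentially. u n < q"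
      then have "\<forall>\<^sub>F n in sequentially. (u \<circ> s) n < q"
        using eventually_subseq[OF s(1)] by simp
      moreover have "\<forall>\<^sub>F n in sequentially. q < (u \<circ> s) n"
        using order_tendstoD(1)[OF s(2) q(3)] .
      ultimately have "\<forall>\<^sub>F n in sequentially. False" by eventually_elim simp
      then show False by simp
    qed
    then have "\<forall>\<^sub>F n in sequentially. \<not> u n < q" using assms(2)[OF q(1)] by blast
    then show "\<forall>\<^sub>F n in sequentially. a < u n" by eventually_elim (use q in simp)
  next
    fix a assume "l < a"
    then obtain q where q: "q \<in> \<rat>" "l < q" "q < a" using Rats_dense_in_real by blast
    have "\<not> (\<forall>\<^sub>F n in sequentially. \<not> u n < q)"
    proof
      assume "\<forall>\<^sub>F n in sequentially. \<not> u n < q"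
      then have "\<forall>\<^sub>F n in sequentially. \<not> (u \<circ> s) n < q"
        using eventually_subseq[OF s(1)] by simp
      moreover have "\<forall>\<^sub>F n in sequentially. (u \<circ> s) n < q"
        using order_tendstoD(2)[OF s(2) q(2)] .
      ultimately have "\<forall>\<^sub>F n in sequentially. False" by eventually_elim simp
      then show False by simp
    qed
    then have "\<forall>\<^sub>F n in sequentially. u n < q" using assms(2)[OF q(1)] by blast
    then show "\<forall>\<^sub>F n in sequentially. u n < a" by eventually_elim (use q in simp)
  qed
  then show ?thesis by (rule convergentI)
qed

lemma set_convergent_subseq:
  "\<lbrakk>strict_mono r; set_convergent X H\<rbrakk> \<Longrightarrow> set_convergent X (H \<circ> r)"
  unfolding set_convergent_def comp_def using eventually_subseq by blast

theorem subinfinite_rank_pointwise_convergent_subseq: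
  fixes f :: "nat \<Rightarrow> 'a \<Rightarrow> real"
  assumes rank: "subinfinite_rank X m"
    and mp: "\<And>n. median_preserving X m UNIV real_median (f n)"
    and bd: "\<And>n x. x \<in> X \<Longrightarrow> \<bar>f n x\<bar> \<le> B"
  shows "\<exists>r g. strict_mono (r :: nat \<Rightarrow> nat) \<and> (\<forall>x\<in>X. (\<lambda>n. f (r n) x) \<longlonglongrightarrow> g x)"
proof -
  \<comment> \<open>\<open>from_nat\<close> enumerates the rationals, so \<open>k\<close> stands for
    the threshold.\<close>
  define H where "H k n = {x \<in> X. f n x < real_of_rat (from_nat k)}" for k :: nat and n
  interpret subseqs "\<lambda>k s. set_convergent X (H k \<circ> s)"
  proof
    fix k and s :: "nat \<Rightarrow> nat"
    show "\<exists>r'. strict_mono r' \<and> set_convergent X (H k \<circ> (s \<circ> r'))"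
      using subinfinite_rank_convergent_subseq[OF rank, of "H k \<circ> s"]
        median_preserving_ray_convex[OF mp] by (simp add: H_def comp_def)
  qed
  \<comment> \<open>From index \<open>Suc k\<close> on, the diagonal runs inside the subsequence
    chosen for threshold \<open>k\<close>.\<close>
  have sub: "set_convergent X (H k \<circ> (diagseq \<circ> (+) (Suc k)))" for k
  proof (rule diagseq_holds)
    fix r s :: "nat \<Rightarrow> nat" and n assume "strict_mono r" "set_convergent X (H n \<circ> s)"
    then show "set_convergent X (H n \<circ> (s \<circ> r))"
      using set_convergent_subseq[of r X "H n \<circ> s"] by (simp add: comp_assoc)
  qed
  have "convergent (\<lambda>n. f (diagseq n) x)" if x: "x \<in> X" for x
  proof (rule convergent_rational_rays)
    show "bounded (range (\<lambda>n. f (diagseq n) x))"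
      using bd[OF x] by (auto simp: bounded_iff)
    fix q :: real assume "q \<in> \<rat>"
    then obtain p where "q = real_of_rat p" by (auto simp: Rats_def)
    then obtain k :: nat where q: "q = real_of_rat (from_nat k)" by (metis from_nat_to_nat)
    have "(\<forall>\<^sub>F n in sequentially. f (diagseq (n + Suc k)) x < q) \<or>
      (\<forall>\<^sub>F n in sequentially. \<not> f (diagseq (n + Suc k)) x < q)"
      using sub[of k] x unfolding set_convergent_def H_def q comp_def by (simp add: add.commute)
    \<comment> \<open>A shift by \<open>Suc k\<close> does not affect eventual behaviour.\<close>
    then show "(\<forall>\<^sub>F n in sequentially. f (diagseq n) x < q) \<or>
      (\<forall>\<^sub>F n in sequentially. \<not> f (diagseq n) x < q)"
      using eventually_sequentially_seg[of "\<lambda>n. f (diagseq n) x < q" "Suc k"]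
        eventually_sequentially_seg[of "\<lambda>n. \<not> f (diagseq n) x < q" "Suc k"] by blast
  qed
  then have "(\<lambda>n. f (diagseq n) x) \<longlonglongrightarrow> lim (\<lambda>n. f (diagseq n) x)" if "x \<in> X" for x
    using that convergent_LIMSEQ_iff by blast
  then show ?thesis
    by (intro exI[of _ diagseq] exI[of _ "\<lambda>x. lim (\<lambda>n. f (diagseq n) x)"] conjI ballI subseq_diagseq)
qed

lemma tendsto_real_median:
  assumes "(f \<longlongrightarrow> a) F" "(g \<longlongrightarrow> b) F" "(h \<longlongrightarrow> c) F"
  shows "((\<lambda>x. real_median (f x) (g x) (h x)) \<longlongrightarrow> real_median a b c) F"
  unfolding real_median_def using assms by (intro tendsto_max tendsto_min)

lemma (in median_algebra) median_preserving_limit: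
  assumes mp: "\<And>n. median_preserving X m UNIV real_median (f n)"
    and lim: "\<And>x. x \<in> X \<Longrightarrow> (\<lambda>n. f n x) \<longlonglongrightarrow> g x"
  shows "median_preserving X m UNIV real_median g"
proof -
  have "g (m x y z) = real_median (g x) (g y) (g z)" if "x \<in> X" "y \<in> X" "z \<in> X" for x y z
  proof (rule LIMSEQ_unique)
    show "(\<lambda>n. f n (m x y z)) \<longlonglongrightarrow> g (m x y z)" using lim closed that by simp
    have "f n (m x y z) = real_median (f n x) (f n y) (f n z)" for n
      using mp that unfolding median_preserving_def by blast
    then show "(\<lambda>n. f n (m x y z)) \<longlonglongrightarrow> real_median (g x) (g y) (g z)"
      using tendsto_real_median[OF lim lim lim] that by simp
  qed
  then show ?thesis unfolding median_preserving_def by simp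
qed

section \<open>Sequential compactness of spaces of median-preserving maps\<close>

lemma (in median_algebra) seq_compactin_median_maps:
  assumes "subinfinite_rank X m"
  shows "seq_compactin (pointwise_topology X {a..b}) (median_maps X m {a..b})"
  unfolding seq_compactin_def
proof (intro conjI allI impI)
  show "median_maps X m {a..b} \<subseteq> topspace (pointwise_topology X {a..b})"
    unfolding median_maps_def pointwise_topology_def by auto
  fix \<sigma> :: "nat \<Rightarrow> 'a \<Rightarrow> real" assume \<sigma>: "\<forall>n. \<sigma> n \<in> median_maps X m {a..b}"
  then have val: "\<sigma> n x \<in> {a..b}" if "x \<in> X" for n x
    using PiE_mem[of "\<sigma> n" X "\<lambda>_. {a..b}" x] that unfolding median_maps_def by simp
  have mp: "median_preserving X m UNIV real_median (\<sigma> n)" for n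
    using \<sigma> unfolding median_maps_def median_preserving_def by simp
  have "\<bar>\<sigma> n x\<bar> \<le> max \<bar>a\<bar> \<bar>b\<bar>" if "x \<in> X" for n x
    using val[OF that, of n] by auto
  then obtain r g where r: "strict_mono (r :: nat \<Rightarrow> nat)"
    and g: "\<forall>x\<in>X. (\<lambda>n. \<sigma> (r n) x) \<longlonglongrightarrow> g x"
    using subinfinite_rank_pointwise_convergent_subseq[where f = \<sigma>, OF assms mp] by blast
  \<comment> \<open>Points of the product topology must be \<open>undefined\<close> outside
    \<open>X\<close>.\<close>
  define l where "l = restrict g X"
  have l: "(\<lambda>n. \<sigma> (r n) x) \<longlonglongrightarrow> l x" if "x \<in> X" for x
    using g that by (simp add: l_def)
  have lval: "l x \<in> {a..b}" if "x \<in> X" for x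
    using closed_sequentially[OF closed_atLeastAtMost _ l[OF that]] val[OF that] by blast
  have "median_preserving X m UNIV real_median l"
    using median_preserving_limit[OF mp l] by simp
  then have "l \<in> median_maps X m {a..b}"
    using lval unfolding median_maps_def median_preserving_def l_def by auto
  moreover have "limitin (pointwise_topology X {a..b}) (\<sigma> \<circ> r) l sequentially"
    unfolding pointwise_topology_def limitin_componentwise
  proof (intro conjI ballI)
    show "l \<in> extensional X" by (simp add: l_def)
    show "\<forall>\<^sub>F n in sequentially. (\<sigma> \<circ> r) n \<in> topspace (product_topology (\<lambda>_. top_of_set {a..b}) X)"
      using \<sigma> unfolding median_maps_def by (simp add: comp_def)
    fix x assume x: "x \<in> X"
    show "limitin (top_of_set {a..b}) (\<lambda>n. (\<sigma> \<circ> r) n x) (l x) sequentially"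
      using l[OF x] lval[OF x] val[OF x] by (simp add: limitin_subtopology comp_def)
  qed
  ultimately show "\<exists>l\<in>median_maps X m {a..b}. \<exists>r. strict_mono r \<and>
      limitin (pointwise_topology X {a..b}) (\<sigma> \<circ> r) l sequentially"
    using r by blast
qed

text \<open>The first implication transfers the rest to finite rank. Every nonempty compact interval
  has the form \<open>{a..b}\<close> with \<open>a <= b\<close>.\<close>

theorem theorem4p1:
  fixes X :: "'a set" and m :: "'a \<Rightarrow> 'a \<Rightarrow> 'a \<Rightarrow> 'a"
  assumes "median_algebra X m"
  shows "(finite_rank X m \<longrightarrow> subinfinite_rank X m) \<and>
    (subinfinite_rank X m \<longrightarrow>
      (\<forall>f :: nat \<Rightarrow> 'a \<Rightarrow> real.
         (\<forall>n. median_preserving X m UNIV real_median (f n)) \<and>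
         (\<exists>B. \<forall>n. \<forall>x\<in>X. \<bar>f n x\<bar> \<le> B) \<longrightarrow>
         (\<exists>(r :: nat \<Rightarrow> nat) (g :: 'a \<Rightarrow> real). strict_mono r \<and>
            (\<forall>x\<in>X. (\<lambda>n. f (r n) x) \<longlonglongrightarrow> g x) \<and>
            median_preserving X m UNIV real_median g)) \<and>
      (\<forall>a b :: real. a \<le> b \<longrightarrow>
         seq_compactin (pointwise_topology X {a..b}) (median_maps X m {a..b})) \<and>
      seq_compactin (pointwise_topology X {0..1}) (median_maps X m {0..1}))"
proof -
  interpret median_algebra X m by fact
  have "\<exists>(r :: nat \<Rightarrow> nat) g. strict_mono r \<and> (\<forall>x\<in>X. (\<lambda>n. f (r n) x) \<longlonglongrightarrow> g x) \<and>
      median_preserving X m UNIV real_median g"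
    if rank: "subinfinite_rank X m" and mp: "\<forall>n. median_preserving X m UNIV real_median (f n)"
      and bd: "\<exists>B. \<forall>n. \<forall>x\<in>X. \<bar>f n x\<bar> \<le> B" for f :: "nat \<Rightarrow> 'a \<Rightarrow> real"
  proof -
    obtain B where B: "\<bar>f n x\<bar> \<le> B" if "x \<in> X" for n x using bd by blast
    obtain r g where r: "strict_mono (r :: nat \<Rightarrow> nat)" "\<forall>x\<in>X. (\<lambda>n. f (r n) x) \<longlonglongrightarrow> g x"
      using subinfinite_rank_pointwise_convergent_subseq[where f = f, OF rank spec[OF mp] B] by blast
    moreover have "median_preserving X m UNIV real_median g"
      using median_preserving_limit[of "\<lambda>n. f (r n)" g] mp r(2) by blast
    ultimately show ?thesis by blast
  qed
  then show ?thesis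
    using finite_rank_imp_subinfinite_rank seq_compactin_median_maps by simp
qed

end
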